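(* Let $F$ be an ordered Pythagorean field and let $ABC$ be a non-equilateral triangle in the cartesian plane $F^2$, with incenter $Q$ and Feuerbach point $Z$ (the point of tangency of the nine-point circle and the incircle of $ABC$). Then the cartesian coordinates of $Z$ lie in the subfield of $F$ generated over $\mathbb{Q}$ by the cartesian coordinates of the vertices $A,B,C$ and the cartesian coordinates of the incenter $Q$.
   Context: An ordered field $F$ is Pythagorean if $\sqrt{1+a^2}\in F$ for every $a\in F$. In $F^2$, lines, betweenness, distance, perpendicularity and circles are defined by the usual cartesian formulas. The nine-point circle of $ABC$ is the circle through the midpoints of the sides, the feet of the altitudes, and the midpoints of the segments joining the orthocenter to the vertices. The incircle is the circle internally tangent to the three sides and the incenter $Q$ is its center. For a non-equilateral triangle the nine-point circle and the incircle are tangent to each other at a single point $Z$, the Feuerbach point. *)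

theory Defs
  imports Complex_Main "HOL-Algebra.Generated_Fields" "HOL-Algebra.Algebraic_Closure_Type"
begin

section \<open>Ordered Pythagorean fields\<close>

class pythagorean_field = linordered_field +
  assumes pythagorean: "\<exists>b. b\<^sup>2 = 1 + a\<^sup>2"

instance real :: pythagorean_field
proof
  show "\<exists>b. b\<^sup>2 = 1 + a\<^sup>2" for a :: real
    by (rule exI[of _ "sqrt (1 + a\<^sup>2)"]) simp
qed

section \<open>The cartesian plane\<close>

type_synonym 'a point = "'a \<times> 'a"

text \<open>The square root in the distance formula is the non-negative one; it exists by
  \<open>distance_ex1\<close> below.\<close>

definition distance :: "'a::pythagorean_field point \<Rightarrow> 'a point \<Rightarrow> 'a" where
  "distance P Q = (THE d. 0 \<le> d \<and> d\<^sup>2 = (fst P - fst Q)\<^sup>2 + (snd P - snd Q)\<^sup>2)"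

text \<open>A line is only meant for two distinct points.\<close>

definition line :: "'a::pythagorean_field point \<Rightarrow> 'a point \<Rightarrow> 'a point set" where
  "line P Q = {V. (fst Q - fst P) * (snd V - snd P) = (snd Q - snd P) * (fst V - fst P)}"

definition strictly_between ::
    "'a::pythagorean_field point \<Rightarrow> 'a point \<Rightarrow> 'a point \<Rightarrow> bool" where
  "strictly_between P V Q \<longleftrightarrow>
     (\<exists>t. 0 < t \<and> t < 1 \<and>
        V = (fst P + t * (fst Q - fst P), snd P + t * (snd Q - snd P)))"

definition circle :: "'a::pythagorean_field point \<Rightarrow> 'a \<Rightarrow> 'a point set" where
  "circle M r = {V. distance V M = r}"

definition mid :: "'a::pythagorean_field point \<Rightarrow> 'a point \<Rightarrow> 'a point" where
  "mid P Q = ((fst P + fst Q) / 2, (snd P + snd Q) / 2)"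

section \<open>Triangles and their circles\<close>

definition triangle ::
    "'a::pythagorean_field point \<Rightarrow> 'a point \<Rightarrow> 'a point \<Rightarrow> bool" where
  "triangle A B C \<longleftrightarrow> A \<noteq> B \<and> C \<notin> line A B"

definition equilateral ::
    "'a::pythagorean_field point \<Rightarrow> 'a point \<Rightarrow> 'a point \<Rightarrow> bool" where
  "equilateral A B C \<longleftrightarrow> distance A B = distance B C \<and> distance B C = distance C A"

text \<open>The altitude \<open>altitude A B C\<close> is the line through \<open>A\<close> perpendicular to the line \<open>B C\<close>.\<close>

definition altitude ::
    "'a::pythagorean_field point \<Rightarrow> 'a point \<Rightarrow> 'a point \<Rightarrow> 'a point set" where
  "altitude A B C =
     {V. (fst V - fst A) * (fst C - fst B) + (snd V - snd A) * (snd C - snd B) = 0}"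

text \<open>In a triangle the foot and the orthocenter exist and are unique, see \<open>foot_ex1\<close> and
  \<open>orthocenter_ex1\<close> below.\<close>

definition foot ::
    "'a::pythagorean_field point \<Rightarrow> 'a point \<Rightarrow> 'a point \<Rightarrow> 'a point" where
  "foot A B C = (THE D. D \<in> altitude A B C \<and> D \<in> line B C)"

definition orthocenter ::
    "'a::pythagorean_field point \<Rightarrow> 'a point \<Rightarrow> 'a point \<Rightarrow> 'a point" where
  "orthocenter A B C =
     (THE H. H \<in> altitude A B C \<and> H \<in> altitude B C A \<and> H \<in> altitude C A B)"

definition nine_points ::
    "'a::pythagorean_field point \<Rightarrow> 'a point \<Rightarrow> 'a point \<Rightarrow> 'a point set" where
  "nine_points A B C =
     {mid B C, mid C A, mid A B,
      foot A B C, foot B C A, foot C A B,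
      mid (orthocenter A B C) A, mid (orthocenter A B C) B, mid (orthocenter A B C) C}"

definition nine_point_circle ::
    "'a::pythagorean_field point \<Rightarrow> 'a point \<Rightarrow> 'a point \<Rightarrow> 'a point \<Rightarrow> 'a \<Rightarrow> bool" where
  "nine_point_circle A B C N R \<longleftrightarrow> 0 < R \<and> nine_points A B C \<subseteq> circle N R"

text \<open>A circle is tangent to a line, or to another circle, if they have exactly one point in
  common. The incircle touches each side line between the two vertices on it; an excircle
  touches two of the side lines outside of the sides.\<close>

definition tangent_to_side ::
    "'a::pythagorean_field point set \<Rightarrow> 'a point \<Rightarrow> 'a point \<Rightarrow> bool" where
  "tangent_to_side K P Q \<longleftrightarrow> (\<exists>T. strictly_between P T Q \<and> line P Q \<inter> K = {T})"

definition incircle ::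
    "'a::pythagorean_field point \<Rightarrow> 'a point \<Rightarrow> 'a point \<Rightarrow> 'a point \<Rightarrow> 'a \<Rightarrow> bool" where
  "incircle A B C Q r \<longleftrightarrow>
     0 < r \<and> tangent_to_side (circle Q r) B C \<and> tangent_to_side (circle Q r) C A
       \<and> tangent_to_side (circle Q r) A B"

definition incenter ::
    "'a::pythagorean_field point \<Rightarrow> 'a point \<Rightarrow> 'a point \<Rightarrow> 'a point \<Rightarrow> bool" where
  "incenter A B C Q \<longleftrightarrow> (\<exists>r. incircle A B C Q r)"

definition feuerbach_point ::
    "'a::pythagorean_field point \<Rightarrow> 'a point \<Rightarrow> 'a point \<Rightarrow> 'a point \<Rightarrow> bool" where
  "feuerbach_point A B C Z \<longleftrightarrow>
     (\<exists>N R Q r. nine_point_circle A B C N R \<and> incircle A B C Q r \<and>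
        circle N R \<inter> circle Q r = {Z})"

section \<open>Subfields generated over the rationals\<close>

definition rat_adjoin :: "'a::field_char_0 set \<Rightarrow> 'a set" where
  "rat_adjoin S = generate_field ring_of_type_algebra (\<rat> \<union> S)"

section \<open>Well-definedness\<close>

lemma distance_ex1:
  fixes x y :: "'a::pythagorean_field"
  shows "\<exists>!d. 0 \<le> d \<and> d\<^sup>2 = x\<^sup>2 + y\<^sup>2"
proof -
  have "\<exists>d. d\<^sup>2 = x\<^sup>2 + y\<^sup>2"
  proof (cases "x = 0")
    case False
    obtain b where "b\<^sup>2 = 1 + (y / x)\<^sup>2"
      using pythagorean by blast
    then have "(x * b)\<^sup>2 = x\<^sup>2 + y\<^sup>2"
      using False by (simp add: power_mult_distrib power_divide field_simps)
    then show ?thesis by blast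
  qed auto
  then obtain d where d: "d\<^sup>2 = x\<^sup>2 + y\<^sup>2" by blast
  show ?thesis
  proof (rule ex1I[of _ "\<bar>d\<bar>"])
    show "0 \<le> \<bar>d\<bar> \<and> \<bar>d\<bar>\<^sup>2 = x\<^sup>2 + y\<^sup>2"
      by (simp add: d)
  next
    fix e assume "0 \<le> e \<and> e\<^sup>2 = x\<^sup>2 + y\<^sup>2"
    then have "0 \<le> e" "e\<^sup>2 = d\<^sup>2" using d by simp_all
    then show "e = \<bar>d\<bar>"
      using power2_eq_iff by fastforce
  qed
qed

lemma distance_nonneg: "0 \<le> distance P Q"
  and distance_power2: "(distance P Q)\<^sup>2 = (fst P - fst Q)\<^sup>2 + (snd P - snd Q)\<^sup>2"
  using theI'[OF distance_ex1[of "fst P - fst Q" "snd P - snd Q"]]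
  by (simp_all add: distance_def)

lemma linear_system_ex1:
  fixes a b c d e f :: "'a::field"
  assumes "a * d - b * c \<noteq> 0"
  shows "\<exists>!V. a * fst V + b * snd V = e \<and> c * fst V + d * snd V = f"
proof -
  define D where "D = a * d - b * c"
  have D: "D \<noteq> 0"
    using assms by (simp add: D_def)
  have "a * (d * e - b * f) + b * (a * f - c * e) = e * D"
    and "c * (d * e - b * f) + d * (a * f - c * e) = f * D"
    by (simp_all add: D_def algebra_simps)
  then have "a * ((d * e - b * f) / D) + b * ((a * f - c * e) / D) = e"
    and "c * ((d * e - b * f) / D) + d * ((a * f - c * e) / D) = f"
    using D by (simp_all only: times_divide_eq_right add_divide_distrib[symmetric]
      nonzero_mult_div_cancel_right not_False_eq_True)
  moreover have "V = W"
    if V: "a * fst V + b * snd V = e" "c * fst V + d * snd V = f"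
      and W: "a * fst W + b * snd W = e" "c * fst W + d * snd W = f" for V W
  proof -
    have "D * fst U = d * (a * fst U + b * snd U) - b * (c * fst U + d * snd U)"
      and "D * snd U = a * (c * fst U + d * snd U) - c * (a * fst U + b * snd U)" for U
      by (simp_all add: D_def algebra_simps)
    then have "D * fst V = D * fst W" "D * snd V = D * snd W"
      using V W by simp_all
    then show ?thesis
      using D by (simp add: prod_eq_iff)
  qed
  ultimately show ?thesis
    by (intro ex1I[of _ "((d * e - b * f) / D, (a * f - c * e) / D)"]) auto
qed

lemma mem_altitude_iff:
  "P \<in> altitude A B C \<longleftrightarrow>
     (fst C - fst B) * fst P + (snd C - snd B) * snd P =
     (fst C - fst B) * fst A + (snd C - snd B) * snd A"
proof -
  have "(fst P - fst A) * (fst C - fst B) + (snd P - snd A) * (snd C - snd B) =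
    ((fst C - fst B) * fst P + (snd C - snd B) * snd P) -
    ((fst C - fst B) * fst A + (snd C - snd B) * snd A)"
    by (simp add: algebra_simps)
  then show ?thesis
    by (simp only: altitude_def mem_Collect_eq right_minus_eq)
qed

lemma mem_line_iff:
  "P \<in> line B C \<longleftrightarrow>
     (snd C - snd B) * fst P + - (fst C - fst B) * snd P =
     (snd C - snd B) * fst B - (fst C - fst B) * snd B"
proof -
  have "(fst C - fst B) * (snd P - snd B) - (snd C - snd B) * (fst P - fst B) =
    - (((snd C - snd B) * fst P + - (fst C - fst B) * snd P) -
       ((snd C - snd B) * fst B - (fst C - fst B) * snd B))"
    by (simp add: algebra_simps)
  then show ?thesis
    unfolding line_def mem_Collect_eq by (metis right_minus_eq neg_equal_0_iff_equal)
qed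

lemma foot_ex1:
  fixes A B C :: "'a::pythagorean_field point"
  assumes "B \<noteq> C"
  shows "\<exists>!D. D \<in> altitude A B C \<and> D \<in> line B C"
proof -
  define u v where uv: "u = fst C - fst B" "v = snd C - snd B"
  have "u * u + v * v \<noteq> 0"
    using assms by (auto simp: uv prod_eq_iff)
  then have "u * (- u) - v * v \<noteq> 0"
    by (metis minus_add_distrib mult_minus_right neg_equal_0_iff_equal diff_conv_add_uminus)
  from linear_system_ex1[OF this] show ?thesis
    unfolding mem_altitude_iff mem_line_iff uv .
qed

lemma orthocenter_ex1:
  fixes A B C :: "'a::pythagorean_field point"
  assumes "triangle A B C"
  shows "\<exists>!H. H \<in> altitude A B C \<and> H \<in> altitude B C A \<and> H \<in> altitude C A B"
proof -
  have "(fst C - fst B) * (snd A - snd C) - (snd C - snd B) * (fst A - fst C) \<noteq> 0"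
    using assms by (simp add: triangle_def line_def algebra_simps)
  note ex1 = linear_system_ex1[OF this]
  have "H \<in> altitude C A B" if "H \<in> altitude A B C" "H \<in> altitude B C A" for H
  proof -
    have "(fst H - fst C) * (fst B - fst A) + (snd H - snd C) * (snd B - snd A) =
      - (((fst H - fst A) * (fst C - fst B) + (snd H - snd A) * (snd C - snd B)) +
         ((fst H - fst B) * (fst A - fst C) + (snd H - snd B) * (snd A - snd C)))"
      by (simp add: algebra_simps)
    then show ?thesis
      using that by (simp only: altitude_def mem_Collect_eq add_0 minus_zero)
  qed
  then have "(\<lambda>H. H \<in> altitude A B C \<and> H \<in> altitude B C A \<and> H \<in> altitude C A B) =
      (\<lambda>H. H \<in> altitude A B C \<and> H \<in> altitude B C A)"
    by blast
  moreover have "\<exists>!H. H \<in> altitude A B C \<and> H \<in> altitude B C A"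
    unfolding mem_altitude_iff by (rule ex1)
  ultimately show ?thesis
    by (simp only:)
qed

lemma rat_adjoin_subfield:
  fixes S :: "'a::field_char_0 set"
  shows "subfield (rat_adjoin S) (ring_of_type_algebra :: 'a ring)"
  unfolding rat_adjoin_def
  by (rule field.generate_field_is_subfield[OF field_from_type_algebra])
    (simp add: ring_of_type_algebra_def)

end

theory Submission
  imports Defs
begin

text \<open>Two circles with different centers that meet in a single point \<open>Z\<close> meet on the line of
  centers, since reflection in that line preserves both circles. So \<open>Z\<close> is the intersection of
  that line with the radical axis, a linear problem whose data are the centers and the
  \<^emph>\<open>squares\<close> of the radii. All of these are rational in the vertices and the incenter: the
  nine-point center is equidistant from the midpoints of the sides, and the incircle touches a
  side in the foot of the perpendicular from the incenter. Feuerbach's theorem itself is not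
  needed, but the incenter has to be unique: the tangent lengths from the vertices
  determine the touching points, and the perpendiculars there determine the center.\<close>

section \<open>Field operations in a generated subfield\<close>

lemma rat_adjoin_incl: "S \<subseteq> rat_adjoin S"
  unfolding rat_adjoin_def by (auto intro: generate_field.incl)

lemma rat_adjoin_Rats: "\<rat> \<subseteq> rat_adjoin S"
  unfolding rat_adjoin_def by (auto intro: generate_field.incl)

lemma rat_adjoin_numeral: "numeral n \<in> rat_adjoin S"
  using rat_adjoin_Rats Rats_number_of by blast

lemma rat_adjoin_add: "x + y \<in> rat_adjoin S"
  if "x \<in> rat_adjoin S" "y \<in> rat_adjoin S"
  using generate_field.eng_add[OF that[unfolded rat_adjoin_def]]
  by (simp add: rat_adjoin_def ring_of_type_algebra_def)

lemma rat_adjoin_mult: "x * y \<in> rat_adjoin S"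
  if "x \<in> rat_adjoin S" "y \<in> rat_adjoin S"
  using generate_field.eng_mult[OF that[unfolded rat_adjoin_def]]
  by (simp add: rat_adjoin_def ring_of_type_algebra_def)

lemma rat_adjoin_uminus: "- x \<in> rat_adjoin S" if "x \<in> rat_adjoin S"
proof -
  have "- 1 \<in> rat_adjoin S"
    using rat_adjoin_Rats[of S] by auto
  from rat_adjoin_mult[OF this that] show ?thesis by simp
qed

lemma rat_adjoin_diff: "x - y \<in> rat_adjoin S"
  if "x \<in> rat_adjoin S" "y \<in> rat_adjoin S"
  using rat_adjoin_add[OF that(1) rat_adjoin_uminus[OF that(2)]] by simp

text \<open>Subfield generation provides inverses of nonzero elements in the ring record. Uniqueness
  of inverses identifies them with \<open>inverse\<close>, and zero is covered by the convention
  \<open>inverse 0 = 0\<close>.\<close>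

lemma rat_adjoin_inverse: "inverse x \<in> rat_adjoin S" if "x \<in> rat_adjoin S"
proof (cases "x = 0")
  case True
  then show ?thesis using that by simp
next
  case False
  define R :: "'a ring" where "R = ring_of_type_algebra"
  interpret field R
    unfolding R_def by (rule field_from_type_algebra)
  have "inv\<^bsub>R\<^esub> x = inverse x"
    by (rule comm_inv_char) (use False in \<open>simp_all add: R_def ring_of_type_algebra_def\<close>)
  moreover have "inv\<^bsub>R\<^esub> x \<in> rat_adjoin S"
    using generate_field.m_inv[OF that[unfolded rat_adjoin_def]] False
    by (simp add: rat_adjoin_def R_def) (simp add: ring_of_type_algebra_def)
  ultimately show ?thesis by simp
qed

lemma rat_adjoin_divide: "x / y \<in> rat_adjoin S"
  if "x \<in> rat_adjoin S" "y \<in> rat_adjoin S"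
  unfolding divide_inverse by (intro rat_adjoin_mult rat_adjoin_inverse that)

lemma rat_adjoin_power: "x ^ n \<in> rat_adjoin S" if "x \<in> rat_adjoin S"
proof (induction n)
  case 0
  then show ?case using rat_adjoin_Rats[of S] by auto
qed (simp add: rat_adjoin_mult that)

lemmas rat_adjoin_closed =
  rat_adjoin_numeral rat_adjoin_add rat_adjoin_mult rat_adjoin_uminus rat_adjoin_diff
  rat_adjoin_divide rat_adjoin_power

text \<open>Cramer's rule. Every point shown to be rational below is exhibited as the solution of
  such a system.\<close>

lemma rat_adjoin_linear_system:
  assumes "a * d - b * c \<noteq> 0"
    and "a * x + b * y = e" "c * x + d * y = f"
    and "{a, b, c, d, e, f} \<subseteq> rat_adjoin S"
  shows "x \<in> rat_adjoin S \<and> y \<in> rat_adjoin S"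
proof -
  have "x * (a * d - b * c) = d * e - b * f" "y * (a * d - b * c) = a * f - c * e"
    unfolding assms(2,3)[symmetric] by (simp_all add: algebra_simps)
  then have "x = (d * e - b * f) / (a * d - b * c)" "y = (a * f - c * e) / (a * d - b * c)"
    using assms(1) by (metis nonzero_mult_div_cancel_right)+
  then show ?thesis
    using assms(4) by (simp add: rat_adjoin_closed)
qed

section \<open>Circles and tangents\<close>

lemma distance_eq_iff:
  "distance P Q = d \<longleftrightarrow> 0 \<le> d \<and> (fst P - fst Q)\<^sup>2 + (snd P - snd Q)\<^sup>2 = d\<^sup>2"
  by (metis distance_nonneg distance_power2 power2_eq_iff_nonneg)

lemma distance_pos: "0 < distance P Q" if "P \<noteq> Q"
proof -
  have "distance P Q \<noteq> 0"
    using that by (auto simp: distance_eq_iff prod_eq_iff sum_power2_eq_zero_iff)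
  then show ?thesis
    using distance_nonneg[of P Q] by simp
qed

text \<open>Here \<open>(fst T - s * u, snd T - s * v)\<close> is the mirror image of \<open>T\<close> in the line through \<open>M\<close>
  perpendicular to \<open>(u, v)\<close>.\<close>

lemma reflection_in_circle:
  assumes "T \<in> circle M r"
    and s: "s * (u\<^sup>2 + v\<^sup>2) = 2 * ((fst T - fst M) * u + (snd T - snd M) * v)"
  shows "(fst T - s * u, snd T - s * v) \<in> circle M r"
proof -
  \<comment> \<open>The squared distance to \<open>M\<close> changes by \<open>s\<close> times the
    difference of the two sides of assumption \<open>s\<close>, which is zero.\<close>
  have "(fst T - s * u - fst M)\<^sup>2 + (snd T - s * v - snd M)\<^sup>2 =
    (fst T - fst M)\<^sup>2 + (snd T - snd M)\<^sup>2 +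
    s * (s * (u\<^sup>2 + v\<^sup>2) - 2 * ((fst T - fst M) * u + (snd T - snd M) * v))"
    by (simp add: power2_eq_square algebra_simps)
  then show ?thesis
    using assms by (simp add: circle_def distance_eq_iff)
qed

text \<open>Reflection in the perpendicular to the line through \<open>M\<close> preserves both the
  line and the circle, so it fixes their only common point \<open>T\<close>.\<close>

lemma tangent_perpendicular:
  assumes "P \<noteq> P'" and "line P P' \<inter> circle M r = {T}"
  shows "(fst T - fst M) * (fst P' - fst P) + (snd T - snd M) * (snd P' - snd P) = 0"
proof -
  define u v where uv: "u = fst P' - fst P" "v = snd P' - snd P"
  define s where "s = 2 * ((fst T - fst M) * u + (snd T - snd M) * v) / (u\<^sup>2 + v\<^sup>2)"
  have uv0: "u\<^sup>2 + v\<^sup>2 \<noteq> 0"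
    using assms(1) by (auto simp: uv prod_eq_iff sum_power2_eq_zero_iff)
  then have s: "s * (u\<^sup>2 + v\<^sup>2) = 2 * ((fst T - fst M) * u + (snd T - snd M) * v)"
    by (simp add: s_def)
  have T: "T \<in> line P P'" "T \<in> circle M r"
    using assms(2) by auto
  have "(fst T - s * u, snd T - s * v) \<in> line P P'"
    using T(1) by (simp add: line_def uv algebra_simps)
  with reflection_in_circle[OF T(2) s] assms(2)
  have "(fst T - s * u, snd T - s * v) = T" by blast
  then have "s * u = 0" "s * v = 0"
    by (simp_all add: prod_eq_iff)
  then have "s * (u\<^sup>2 + v\<^sup>2) = 0"
    by (auto simp: power2_eq_square)
  from trans[OF s[symmetric] this] show ?thesis
    unfolding uv by (simp only: mult_eq_0_iff numeral_neq_zero simp_thms)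
qed

lemma tangent_circles_collinear:
  assumes "N \<noteq> M" and "circle N R \<inter> circle M r = {Z}"
  shows "(snd M - snd N) * (fst Z - fst N) - (fst M - fst N) * (snd Z - snd N) = 0"
proof -
  \<comment> \<open>A normal vector of the line of centers, so that the reflection is the one in
    this line.\<close>
  define u v where uv: "u = snd M - snd N" "v = - (fst M - fst N)"
  define s where "s = 2 * ((fst Z - fst N) * u + (snd Z - snd N) * v) / (u\<^sup>2 + v\<^sup>2)"
  have "u\<^sup>2 + v\<^sup>2 \<noteq> 0"
    using assms(1) by (auto simp: uv prod_eq_iff sum_power2_eq_zero_iff)
  then have s: "s * (u\<^sup>2 + v\<^sup>2) = 2 * ((fst Z - fst N) * u + (snd Z - snd N) * v)"
    by (simp add: s_def)
  \<comment> \<open>The vector from \<open>N\<close> to \<open>M\<close> is orthogonal to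
    \<open>(u, v)\<close>, so the same \<open>s\<close> describes the reflection for either
    center.\<close>
  also have "\<dots> = 2 * ((fst Z - fst M) * u + (snd Z - snd M) * v)"
    by (simp add: uv algebra_simps)
  finally have s': "s * (u\<^sup>2 + v\<^sup>2) = \<dots>" .
  have "(fst Z - s * u, snd Z - s * v) = Z"
    using reflection_in_circle[OF _ s, of R] reflection_in_circle[OF _ s', of r] assms(2)
    by blast
  then have "s * u = 0" "s * v = 0"
    by (simp_all add: prod_eq_iff)
  then have "s * (u\<^sup>2 + v\<^sup>2) = 0"
    by (auto simp: power2_eq_square)
  then show ?thesis
    using s by (simp add: uv algebra_simps)
qed

text \<open>Pythagoras in the triangle \<open>P T M\<close>, whose right angle is at
  \<open>T\<close>.\<close>

lemma tangent_length:
  assumes "(fst T - fst M) * (fst P - fst T) + (snd T - snd M) * (snd P - snd T) = 0"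
    and "T \<in> circle M r"
  shows "(distance P T)\<^sup>2 = (distance P M)\<^sup>2 - r\<^sup>2"
proof -
  have "(fst P - fst M)\<^sup>2 + (snd P - snd M)\<^sup>2 =
    (fst P - fst T)\<^sup>2 + (snd P - snd T)\<^sup>2 + ((fst T - fst M)\<^sup>2 + (snd T - snd M)\<^sup>2) +
    2 * ((fst T - fst M) * (fst P - fst T) + (snd T - snd M) * (snd P - snd T))"
    by (simp add: power2_eq_square algebra_simps)
  then show ?thesis
    using assms by (simp add: distance_power2 circle_def distance_eq_iff)
qed

text \<open>The touching point divides the side in the ratio \<open>t\<close> to
  \<open>1 - t\<close>. The last equation says that \<open>M\<close> lies on the perpendicular to
  the side at this point.\<close>

lemma tangent_to_side_lengths:
  assumes "tangent_to_side (circle M r) P P'" and "P \<noteq> P'"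
  obtains t where "0 < t" "t < 1"
    and "(t * distance P P')\<^sup>2 = (distance P M)\<^sup>2 - r\<^sup>2"
    and "((1 - t) * distance P P')\<^sup>2 = (distance P' M)\<^sup>2 - r\<^sup>2"
    and "(fst P' - fst P) * fst M + (snd P' - snd P) * snd M =
      (fst P' - fst P) * (fst P + t * (fst P' - fst P)) +
      (snd P' - snd P) * (snd P + t * (snd P' - snd P))"
proof -
  obtain t where t: "0 < t" "t < 1"
    and T: "line P P' \<inter> circle M r = {(fst P + t * (fst P' - fst P), snd P + t * (snd P' - snd P))}"
    using assms(1) by (auto simp: tangent_to_side_def strictly_between_def)
  let ?T = "(fst P + t * (fst P' - fst P), snd P + t * (snd P' - snd P))"
  have inc: "?T \<in> circle M r"
    using T by blast
  \<comment> \<open>The vanishing product of radius and side direction; the right-angle conditions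
    for both endpoints are multiples of it.\<close>
  define k where "k = (fst ?T - fst M) * (fst P' - fst P) + (snd ?T - snd M) * (snd P' - snd P)"
  have k: "k = 0"
    unfolding k_def by (rule tangent_perpendicular[OF assms(2) T])
  have "(fst ?T - fst M) * (fst P - fst ?T) + (snd ?T - snd M) * (snd P - snd ?T) = - t * k"
    and "(fst ?T - fst M) * (fst P' - fst ?T) + (snd ?T - snd M) * (snd P' - snd ?T) = (1 - t) * k"
    by (simp_all add: k_def algebra_simps)
  then have "(distance P ?T)\<^sup>2 = (distance P M)\<^sup>2 - r\<^sup>2" "(distance P' ?T)\<^sup>2 = (distance P' M)\<^sup>2 - r\<^sup>2"
    using k by (auto intro!: tangent_length[OF _ inc])
  moreover have "(distance P ?T)\<^sup>2 = (t * distance P P')\<^sup>2"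
    "(distance P' ?T)\<^sup>2 = ((1 - t) * distance P P')\<^sup>2"
    by (simp_all add: distance_power2 power_mult_distrib) (simp_all add: power2_eq_square algebra_simps)
  moreover have "(fst P' - fst P) * fst M + (snd P' - snd P) * snd M =
      (fst P' - fst P) * fst ?T + (snd P' - snd P) * snd ?T - k"
    by (simp add: k_def algebra_simps)
  ultimately show thesis
    using that t k by simp
qed

section \<open>The incenter\<close>

text \<open>Twice the signed area, in the form in which it appears as the determinant of the linear
  systems below.\<close>

lemma triangle_det:
  assumes "triangle A B C"
  shows "(fst C - fst B) * (snd A - snd C) - (snd C - snd B) * (fst A - fst C) \<noteq> 0"
  using assms by (simp add: triangle_def line_def algebra_simps)

lemma triangle_distinct:
  assumes "triangle A B C"
  shows "B \<noteq> C" "C \<noteq> A" "A \<noteq> B"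
  using triangle_det[OF assms] by (auto simp: algebra_simps)

text \<open>The two tangent lengths from each vertex agree. This gives three linear equations,
  solved by the semiperimeter minus the opposite side; the radius drops out.\<close>

lemma incircle_equations:
  assumes "triangle A B C" and "incircle A B C Q r"
  shows "\<exists>t u.
    t * distance B C = (distance B C + distance A B - distance C A) / 2 \<and>
    u * distance C A = (distance C A + distance B C - distance A B) / 2 \<and>
    (fst C - fst B) * fst Q + (snd C - snd B) * snd Q =
      (fst C - fst B) * (fst B + t * (fst C - fst B)) +
      (snd C - snd B) * (snd B + t * (snd C - snd B)) \<and>
    (fst A - fst C) * fst Q + (snd A - snd C) * snd Q =
      (fst A - fst C) * (fst C + u * (fst A - fst C)) +
      (snd A - snd C) * (snd C + u * (snd A - snd C))"
proof -
  note ne = triangle_distinct[OF assms(1)]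
  have tan: "tangent_to_side (circle Q r) B C" "tangent_to_side (circle Q r) C A"
    "tangent_to_side (circle Q r) A B"
    using assms(2) by (auto simp: incircle_def)
  obtain t where t: "0 < t" "t < 1"
    "(t * distance B C)\<^sup>2 = (distance B Q)\<^sup>2 - r\<^sup>2"
    "((1 - t) * distance B C)\<^sup>2 = (distance C Q)\<^sup>2 - r\<^sup>2"
    and t_eq: "(fst C - fst B) * fst Q + (snd C - snd B) * snd Q =
      (fst C - fst B) * (fst B + t * (fst C - fst B)) +
      (snd C - snd B) * (snd B + t * (snd C - snd B))"
    by (rule tangent_to_side_lengths[OF tan(1) ne(1)])
  obtain u where u: "0 < u" "u < 1"
    "(u * distance C A)\<^sup>2 = (distance C Q)\<^sup>2 - r\<^sup>2"
    "((1 - u) * distance C A)\<^sup>2 = (distance A Q)\<^sup>2 - r\<^sup>2"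
    and u_eq: "(fst A - fst C) * fst Q + (snd A - snd C) * snd Q =
      (fst A - fst C) * (fst C + u * (fst A - fst C)) +
      (snd A - snd C) * (snd C + u * (snd A - snd C))"
    by (rule tangent_to_side_lengths[OF tan(2) ne(2)])
  obtain v where v: "0 < v" "v < 1"
    "(v * distance A B)\<^sup>2 = (distance A Q)\<^sup>2 - r\<^sup>2"
    "((1 - v) * distance A B)\<^sup>2 = (distance B Q)\<^sup>2 - r\<^sup>2"
    by (rule tangent_to_side_lengths[OF tan(3) ne(3)])
  \<comment> \<open>Tangent lengths at \<open>C\<close>, \<open>A\<close> and \<open>B\<close>:
    their squares agree and they are non-negative.\<close>
  have "(1 - t) * distance B C = u * distance C A"
    "(1 - u) * distance C A = v * distance A B"
    "(1 - v) * distance A B = t * distance B C"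
    by (rule power2_eq_imp_eq; use t u v in \<open>simp add: distance_nonneg\<close>)+
  then have "t * distance B C = (distance B C + distance A B - distance C A) / 2"
    "u * distance C A = (distance C A + distance B C - distance A B) / 2"
    by (simp_all add: algebra_simps)
  then show ?thesis
    using t_eq u_eq by blast
qed

text \<open>The side lengths fix \<open>t\<close> and \<open>u\<close>, so both centers solve the
  same nonsingular system: the perpendiculars to two sides at the touching points.\<close>

lemma incenter_unique:
  assumes "triangle A B C" and "incircle A B C Q r" and "incircle A B C Q' r'"
  shows "Q = Q'"
proof -
  obtain t u where tu:
    "t * distance B C = (distance B C + distance A B - distance C A) / 2"
    "u * distance C A = (distance C A + distance B C - distance A B) / 2"
    and Q: "(fst C - fst B) * fst Q + (snd C - snd B) * snd Q =
      (fst C - fst B) * (fst B + t * (fst C - fst B)) +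
      (snd C - snd B) * (snd B + t * (snd C - snd B))"
      "(fst A - fst C) * fst Q + (snd A - snd C) * snd Q =
      (fst A - fst C) * (fst C + u * (fst A - fst C)) +
      (snd A - snd C) * (snd C + u * (snd A - snd C))"
    using incircle_equations[OF assms(1,2)] by blast
  obtain t' u' where tu':
    "t' * distance B C = (distance B C + distance A B - distance C A) / 2"
    "u' * distance C A = (distance C A + distance B C - distance A B) / 2"
    and Q': "(fst C - fst B) * fst Q' + (snd C - snd B) * snd Q' =
      (fst C - fst B) * (fst B + t' * (fst C - fst B)) +
      (snd C - snd B) * (snd B + t' * (snd C - snd B))"
      "(fst A - fst C) * fst Q' + (snd A - snd C) * snd Q' =
      (fst A - fst C) * (fst C + u' * (fst A - fst C)) +
      (snd A - snd C) * (snd C + u' * (snd A - snd C))"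
    using incircle_equations[OF assms(1,3)] by blast
  from triangle_distinct(1,2)[OF assms(1), THEN distance_pos] tu tu' have "t' = t" "u' = u"
    by (metis mult_cancel_right less_irrefl)+
  with linear_system_ex1[OF triangle_det[OF assms(1)]] Q Q' show ?thesis
    by blast
qed

text \<open>The touching point on \<open>B C\<close> is the foot of the perpendicular from
  \<open>Q\<close>, and \<open>r\<^sup>2\<close> is its squared distance from \<open>Q\<close>, so
  no square root is taken.\<close>

lemma incircle_radius_rational:
  assumes "B \<noteq> C" and "incircle A B C Q r"
    and "{fst B, snd B, fst C, snd C, fst Q, snd Q} \<subseteq> rat_adjoin S"
  shows "r\<^sup>2 \<in> rat_adjoin S"
proof -
  obtain T where T: "line B C \<inter> circle Q r = {T}"
    using assms(2) by (auto simp: incircle_def tangent_to_side_def)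
  have det: "(fst C - fst B) * - (fst C - fst B) - (snd C - snd B) * (snd C - snd B) \<noteq> 0"
  proof -
    have "(fst C - fst B)\<^sup>2 + (snd C - snd B)\<^sup>2 \<noteq> 0"
      using assms(1) by (auto simp: prod_eq_iff sum_power2_eq_zero_iff)
    then show ?thesis
      by (simp add: power2_eq_square algebra_simps)
  qed
  have "(fst C - fst B) * fst T + (snd C - snd B) * snd T =
      (fst C - fst B) * fst Q + (snd C - snd B) * snd Q"
    using tangent_perpendicular[OF assms(1) T] by (simp add: algebra_simps)
  moreover have "(snd C - snd B) * fst T + - (fst C - fst B) * snd T =
      (snd C - snd B) * fst B - (fst C - fst B) * snd B"
    using T mem_line_iff by blast
  ultimately have "fst T \<in> rat_adjoin S \<and> snd T \<in> rat_adjoin S"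
    using assms(3) by (intro rat_adjoin_linear_system[OF det]) (auto intro!: rat_adjoin_closed)
  moreover have "T \<in> circle Q r"
    using T by blast
  then have "r\<^sup>2 = (fst T - fst Q)\<^sup>2 + (snd T - snd Q)\<^sup>2"
    by (auto simp: circle_def distance_power2)
  ultimately show ?thesis
    using assms(3) by (simp add: rat_adjoin_closed)
qed

section \<open>The nine-point circle\<close>

text \<open>Subtracting circle equations cancels \<open>R\<^sup>2\<close> and the squares of the
  coordinates of \<open>N\<close>, leaving two perpendicular bisectors.\<close>

lemma circumcenter_rational:
  assumes "triangle D E F" and "{D, E, F} \<subseteq> circle N R"
    and "{fst D, snd D, fst E, snd E, fst F, snd F} \<subseteq> rat_adjoin S"
  shows "fst N \<in> rat_adjoin S \<and> snd N \<in> rat_adjoin S"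
proof (rule rat_adjoin_linear_system[OF triangle_det[OF assms(1)]])
  have "(fst D - fst N)\<^sup>2 + (snd D - snd N)\<^sup>2 = R\<^sup>2"
    "(fst E - fst N)\<^sup>2 + (snd E - snd N)\<^sup>2 = R\<^sup>2"
    "(fst F - fst N)\<^sup>2 + (snd F - snd N)\<^sup>2 = R\<^sup>2"
    using assms(2) by (auto simp: circle_def distance_power2[symmetric])
  then show "(fst F - fst E) * fst N + (snd F - snd E) * snd N =
      ((fst F)\<^sup>2 + (snd F)\<^sup>2 - (fst E)\<^sup>2 - (snd E)\<^sup>2) / 2"
    "(fst D - fst F) * fst N + (snd D - snd F) * snd N =
      ((fst D)\<^sup>2 + (snd D)\<^sup>2 - (fst F)\<^sup>2 - (snd F)\<^sup>2) / 2"
    by (simp_all add: power2_eq_square algebra_simps)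
qed (use assms(3) in \<open>auto intro!: rat_adjoin_closed\<close>)

lemma triangle_mid:
  assumes "triangle A B C"
  shows "triangle (mid B C) (mid C A) (mid A B)"
proof -
  \<comment> \<open>The medial triangle has a quarter of the area.\<close>
  have "4 * ((fst (mid C A) - fst (mid B C)) * (snd (mid A B) - snd (mid B C)) -
      (snd (mid C A) - snd (mid B C)) * (fst (mid A B) - fst (mid B C))) =
    (fst C - fst B) * (snd A - snd C) - (snd C - snd B) * (fst A - fst C)"
    by (simp add: mid_def field_simps)
  then have "(fst (mid C A) - fst (mid B C)) * (snd (mid A B) - snd (mid B C)) -
      (snd (mid C A) - snd (mid B C)) * (fst (mid A B) - fst (mid B C)) \<noteq> 0"
    using triangle_det[OF assms] by auto
  then show ?thesis
    by (auto simp: triangle_def line_def)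
qed

text \<open>\<open>N\<close> is the circumcenter of the medial triangle, and
  \<open>R\<^sup>2\<close> its squared distance from a midpoint.\<close>

lemma nine_point_circle_rational:
  assumes "triangle A B C" and "nine_point_circle A B C N R"
    and "{fst A, snd A, fst B, snd B, fst C, snd C} \<subseteq> rat_adjoin S"
  shows "{fst N, snd N, R\<^sup>2} \<subseteq> rat_adjoin S"
proof -
  have sub: "{mid B C, mid C A, mid A B} \<subseteq> circle N R"
    using assms(2) by (auto simp: nine_point_circle_def nine_points_def)
  have mid: "{fst (mid B C), snd (mid B C), fst (mid C A), snd (mid C A),
      fst (mid A B), snd (mid A B)} \<subseteq> rat_adjoin S"
    using assms(3) by (auto simp: mid_def intro!: rat_adjoin_closed)
  have N: "fst N \<in> rat_adjoin S \<and> snd N \<in> rat_adjoin S"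
    by (rule circumcenter_rational[OF triangle_mid[OF assms(1)] sub mid])
  have "R\<^sup>2 = (fst (mid B C) - fst N)\<^sup>2 + (snd (mid B C) - snd N)\<^sup>2"
    using sub by (auto simp: circle_def distance_power2)
  then show ?thesis
    using N mid by (simp add: rat_adjoin_closed)
qed

section \<open>The Feuerbach point\<close>

lemma tangency_point_rational:
  assumes "N \<noteq> M" and "circle N R \<inter> circle M r = {Z}"
    and "{fst N, snd N, R\<^sup>2, fst M, snd M, r\<^sup>2} \<subseteq> rat_adjoin S"
  shows "fst Z \<in> rat_adjoin S \<and> snd Z \<in> rat_adjoin S"
proof (rule rat_adjoin_linear_system)
  have "(fst M - fst N)\<^sup>2 + (snd M - snd N)\<^sup>2 \<noteq> 0"
    using assms(1) by (auto simp: prod_eq_iff sum_power2_eq_zero_iff)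
  then show "(fst M - fst N) * - (fst M - fst N) - (snd M - snd N) * (snd M - snd N) \<noteq> 0"
    by (simp add: power2_eq_square algebra_simps)
  show "(snd M - snd N) * fst Z + - (fst M - fst N) * snd Z =
      (snd M - snd N) * fst N - (fst M - fst N) * snd N"
    using tangent_circles_collinear[OF assms(1,2)] by (simp add: algebra_simps)
  have "Z \<in> circle N R" "Z \<in> circle M r"
    using assms(2) by auto
  then have "(fst Z - fst N)\<^sup>2 + (snd Z - snd N)\<^sup>2 = R\<^sup>2"
    "(fst Z - fst M)\<^sup>2 + (snd Z - snd M)\<^sup>2 = r\<^sup>2"
    by (auto simp: circle_def distance_power2[symmetric])
  \<comment> \<open>The radical axis, as the difference of the two circle equations; it is
    perpendicular to the line of centers.\<close>
  then show "(fst M - fst N) * fst Z + (snd M - snd N) * snd Z =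
      (R\<^sup>2 - r\<^sup>2 + (fst M)\<^sup>2 + (snd M)\<^sup>2 - (fst N)\<^sup>2 - (snd N)\<^sup>2) / 2"
    by (simp add: power2_eq_square algebra_simps)
qed (use assms(3) in \<open>auto intro!: rat_adjoin_closed\<close>)

text \<open>Concentric circles with a common point coincide, so the nine-point circle would be the
  single point \<open>Z\<close>, although it contains distinct midpoints.\<close>

lemma nine_point_center_neq_incenter:
  assumes "triangle A B C" and "nine_point_circle A B C N R"
    and "circle N R \<inter> circle M r = {Z}"
  shows "N \<noteq> M"
proof
  assume "N = M"
  have "Z \<in> circle N R" "Z \<in> circle M r"
    using assms(3) by blast+
  with \<open>N = M\<close> have "R = r"
    by (simp add: circle_def)
  with \<open>N = M\<close> have "circle N R = {Z}"
    using assms(3) by simp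
  then have "mid B C = mid C A"
    using assms(2) by (auto simp: nine_point_circle_def nine_points_def)
  then show False
    using triangle_mid[OF assms(1)] by (simp add: triangle_def)
qed

theorem mainTheorem4:
  fixes A B C Q Z :: "'a::pythagorean_field point"
  assumes "triangle A B C"
    and "\<not> equilateral A B C"
    and "incenter A B C Q"
    and "feuerbach_point A B C Z"
  shows "{fst Z, snd Z} \<subseteq>
    rat_adjoin {fst A, snd A, fst B, snd B, fst C, snd C, fst Q, snd Q}"
proof -
  let ?S = "{fst A, snd A, fst B, snd B, fst C, snd C, fst Q, snd Q}"
  obtain N R Q' r where N: "nine_point_circle A B C N R" and Q': "incircle A B C Q' r"
    and Z: "circle N R \<inter> circle Q' r = {Z}"
    using assms(4) by (auto simp: feuerbach_point_def)
  \<comment> \<open>\<open>feuerbach_point\<close> quantifies over its own incircle, whose center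
    has to be identified with the given \<open>Q\<close>.\<close>
  have "Q' = Q"
    using incenter_unique[OF assms(1) Q'] assms(3) unfolding incenter_def by blast
  note Q = Q'[unfolded this] and Z = Z[unfolded this]
  have "r\<^sup>2 \<in> rat_adjoin ?S"
    using incircle_radius_rational[OF triangle_distinct(1)[OF assms(1)] Q] rat_adjoin_incl[of ?S] by blast
  moreover have "{fst N, snd N, R\<^sup>2} \<subseteq> rat_adjoin ?S"
    using nine_point_circle_rational[OF assms(1) N] rat_adjoin_incl[of ?S] by blast
  ultimately have "{fst N, snd N, R\<^sup>2, fst Q, snd Q, r\<^sup>2} \<subseteq> rat_adjoin ?S"
    using rat_adjoin_incl[of ?S] by blast
  from tangency_point_rational[OF nine_point_center_neq_incenter[OF assms(1) N Z] Z this]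
  show ?thesis by simp
qed

end
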